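(* Let $f:\mathbb{R}^n\to\mathbb{R}$ satisfy the standing assumptions with constants $L>0$ and $\kappa\ge 1$, and let $d=\frac{1}{\sqrt{\kappa}+1}$, $\beta=\frac{\sqrt{\kappa}-1}{\sqrt{\kappa}+1}$. The second-order differential equation $$\ddot{x}(t)+2d\,\dot{x}(t)+\frac{1}{L}\nabla f(x(t)+\beta\dot{x}(t))=0$$ is, with $q=x$ and $p=\dot{x}$, equivalent to the first-order system $\dot q=\nabla T(p)$, $\dot p=-\frac1L\nabla f(q)+f_{\mathrm{NP}}(q,p)$, where $T(p)=\frac12|p|^2$ and $f_{\mathrm{NP}}(q,p)=-2dp-\frac{1}{L}(\nabla f(q+\beta p)-\nabla f(q))$. Moreover, let $(q_k,p_k)_{k\ge 0}$ be any sequence in $\mathbb{R}^n\times\mathbb{R}^n$ generated by the semi-implicit Euler discretization of this system with step size $T_{\mathrm{s}}=1$, and define $x_k:=q_k$ and $y_k:=q_k+\beta p_k$. Then for all $k\ge 0$ $$x_{k+1}=y_k-\frac{1}{L}\nabla f(y_k),\qquad y_{k+1}=x_{k+1}+\beta(x_{k+1}-x_k),$$ i.e. $(x_k,y_k)$ follows Nesterov's accelerated gradient scheme with constant step size.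
   Context: Standing assumptions: $f:\mathbb{R}^n\to\mathbb{R}$ is differentiable, its gradient $\nabla f$ is Lipschitz continuous with constant $L>0$, and $f$ is strongly convex with condition number $\kappa\ge1$, i.e. $f(x)\ge f(\bar x)+\nabla f(\bar x)^{\mathsf T}(x-\bar x)+\frac{L}{2\kappa}|x-\bar x|^2$ for all $x,\bar x\in\mathbb{R}^n$; $f$ attains its minimum at $0$ and $f(0)=0$. $|\cdot|$ is the Euclidean norm. The semi-implicit Euler discretization with step size $T_{\mathrm{s}}>0$ of the system $\dot q=\nabla T(p)$, $\dot p=-\frac1L\nabla f(q)+f_{\mathrm{NP}}(q,p)$ is $$p_{k+1}=p_k+T_{\mathrm{s}}\Big(-\frac1L\nabla f(q_k)+f_{\mathrm{NP}}(q_k,p_k)\Big),\qquad q_{k+1}=q_k+T_{\mathrm{s}}\nabla T(p_{k+1}).$$ *)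

theory Defs
  imports "HOL-Analysis.Analysis"
begin

text \<open>The gradient is a total function; at points of non-differentiability its value is unspecified.\<close>

definition gradient :: "('a::real_inner \<Rightarrow> real) \<Rightarrow> 'a \<Rightarrow> 'a"
  where "gradient f x = (THE D. GDERIV f x :> D)"

text \<open>
  Trajectories are considered on a set \<open>I\<close> of times, with derivatives taken within \<open>I\<close>
  (one-sided at an end point of an interval that belongs to it).
\<close>

definition time_deriv :: "real set \<Rightarrow> (real \<Rightarrow> 'a::real_normed_vector) \<Rightarrow> real \<Rightarrow> 'a"
  where "time_deriv I x t = vector_derivative x (at t within I)"

definition solves_second_order ::
    "('a::real_inner \<Rightarrow> real) \<Rightarrow> real \<Rightarrow> real \<Rightarrow> real \<Rightarrow> real set \<Rightarrow> (real \<Rightarrow> 'a) \<Rightarrow> bool"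
  where "solves_second_order f L d \<beta> I x \<longleftrightarrow>
    (\<forall>t\<in>I. x differentiable (at t within I)) \<and>
    (\<forall>t\<in>I. time_deriv I x differentiable (at t within I)) \<and>
    (\<forall>t\<in>I. time_deriv I (time_deriv I x) t + (2 * d) *\<^sub>R time_deriv I x t
       + (1 / L) *\<^sub>R gradient f (x t + \<beta> *\<^sub>R time_deriv I x t) = 0)"

definition solves_first_order ::
    "('a::real_inner \<Rightarrow> real) \<Rightarrow> real \<Rightarrow> ('a \<Rightarrow> real) \<Rightarrow> ('a \<Rightarrow> 'a \<Rightarrow> 'a)
      \<Rightarrow> real set \<Rightarrow> (real \<Rightarrow> 'a) \<Rightarrow> (real \<Rightarrow> 'a) \<Rightarrow> bool"
  where "solves_first_order f L T F I q p \<longleftrightarrow>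
    (\<forall>t\<in>I. (q has_vector_derivative gradient T (p t)) (at t within I)) \<and>
    (\<forall>t\<in>I. (p has_vector_derivative - ((1 / L) *\<^sub>R gradient f (q t)) + F (q t) (p t)) (at t within I))"

definition semi_implicit_euler ::
    "('a::real_inner \<Rightarrow> real) \<Rightarrow> real \<Rightarrow> ('a \<Rightarrow> real) \<Rightarrow> ('a \<Rightarrow> 'a \<Rightarrow> 'a)
      \<Rightarrow> real \<Rightarrow> (nat \<Rightarrow> 'a) \<Rightarrow> (nat \<Rightarrow> 'a) \<Rightarrow> bool"
  where "semi_implicit_euler f L T F Ts q p \<longleftrightarrow>
    (\<forall>k. p (Suc k) = p k + Ts *\<^sub>R (- ((1 / L) *\<^sub>R gradient f (q k)) + F (q k) (p k)) \<and>
         q (Suc k) = q k + Ts *\<^sub>R gradient T (p (Suc k)))"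

end

theory Submission
  imports Defs
begin

text \<open>
  The damping and the extrapolation parameter are linked by \<open>\<beta> = 1 - 2 d\<close>, and the gradient of the
  kinetic energy \<open>p \<mapsto> |p|\<^sup>2 / 2\<close> is the identity. In the momentum equation the two terms
  \<open>\<nabla>f(q) / L\<close> cancel, so that the conservative force and the non-potential force
  together are \<open>- 2 d p - \<nabla>f(q + \<beta> p) / L\<close>. Both claims follow from this.

  Continuous time: the first equation of the system says that \<open>p\<close> is the velocity of \<open>q\<close>, and
  the second one is then the second-order equation solved for the acceleration. Passing between
  ``\<open>p\<close> is a derivative of \<open>q\<close>'' and ``\<open>p\<close> is the velocity of \<open>q\<close>'' needs derivatives within
  the time interval to be unique, which holds because a nondegenerate interval has no isolated points.

  Discrete time: with unit step the momentum update reads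
  \<open>p\<^sub>k\<^sub>+\<^sub>1 = \<beta> p\<^sub>k - \<nabla>f(y\<^sub>k) / L\<close>, where the coefficient \<open>\<beta>\<close> is \<open>1 - 2 d\<close>. As
  \<open>y\<^sub>k = q\<^sub>k + \<beta> p\<^sub>k\<close>, adding \<open>q\<^sub>k\<close> gives the gradient step from \<open>y\<^sub>k\<close>; and
  \<open>p\<^sub>k\<^sub>+\<^sub>1 = q\<^sub>k\<^sub>+\<^sub>1 - q\<^sub>k\<close> turns the definition of \<open>y\<^sub>k\<^sub>+\<^sub>1\<close> into the extrapolation step.
\<close>

lemma gradient_eqI:
  assumes "GDERIV f x :> D"
  shows "gradient f x = D"
  unfolding gradient_def
proof (rule the_equality)
  fix E assume "GDERIV f x :> E"
  with assms have "(\<lambda>h. h \<bullet> E) = (\<lambda>h. h \<bullet> D)"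
    unfolding gderiv_def by (rule has_derivative_unique[rotated])
  then have "\<forall>h. h \<bullet> E = h \<bullet> D"
    by (simp add: fun_eq_iff)
  then show "E = D"
    by (simp only: vector_eq_ldot)
qed (fact assms)

lemma gradient_kinetic_energy: "gradient (\<lambda>p. 1 / 2 * (norm p)\<^sup>2) p = p"
proof (rule gradient_eqI)
  have "((\<lambda>p. 1 / 2 * (p \<bullet> p)) has_derivative (\<lambda>h. h \<bullet> p)) (at p)"
    by (auto intro!: derivative_eq_intros simp: inner_commute)
  then show "GDERIV (\<lambda>p. 1 / 2 * (norm p)\<^sup>2) p :> p"
    by (simp add: gderiv_def power2_norm_eq_inner)
qed

lemma at_within_nondegenerate_interval_neq_bot:
  fixes I :: "real set"
  assumes "is_interval I" "interior I \<noteq> {}" "t \<in> I"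
  shows "at t within I \<noteq> bot"
proof -
  have "I \<noteq> {s}" for s
    using assms(2) by (metis interior_singleton)
  then have "t islimpt I"
    by (rule connected_imp_perfect[OF is_interval_connected[OF assms(1)] assms(3)])
  then show ?thesis
    by (simp add: trivial_limit_within)
qed

lemma time_deriv_eqI:
  assumes "is_interval I" "interior I \<noteq> {}" "t \<in> I"
    and "(x has_vector_derivative v) (at t within I)"
  shows "time_deriv I x t = v"
  unfolding time_deriv_def
  using at_within_nondegenerate_interval_neq_bot[OF assms(1-3)] assms(4)
  by (rule vector_derivative_within)

lemma has_time_deriv:
  assumes "x differentiable (at t within I)"
  shows "(x has_vector_derivative time_deriv I x t) (at t within I)"
  unfolding time_deriv_def using assms by (simp add: vector_derivative_works)

text \<open>
  Only the sum of the two forces enters the system, so it is the sum that is prescribed here, not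
  \<open>F\<close> by itself; it has the same form in the discrete case.
\<close>

lemma first_order_iff_second_order:
  fixes f :: "'a::real_inner \<Rightarrow> real"
  assumes I: "is_interval I" "interior I \<noteq> {}"
    and T: "\<And>v. gradient T v = v"
    and F: "\<And>u v. - ((1 / L) *\<^sub>R gradient f u) + F u v
      = - ((2 * d) *\<^sub>R v) - (1 / L) *\<^sub>R gradient f (u + \<beta> *\<^sub>R v)"
  shows "solves_first_order f L T F I q p \<longleftrightarrow>
    solves_second_order f L d \<beta> I q \<and> (\<forall>t\<in>I. p t = time_deriv I q t)" (is "?lhs \<longleftrightarrow> ?rhs")
proof
  assume ?lhs
  then have q': "(q has_vector_derivative p t) (at t within I)"
    and p': "(p has_vector_derivative
      - ((2 * d) *\<^sub>R p t) - (1 / L) *\<^sub>R gradient f (q t + \<beta> *\<^sub>R p t)) (at t within I)"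
    if "t \<in> I" for t
    using that unfolding solves_first_order_def T F by auto
  have velocity: "time_deriv I q t = p t" if "t \<in> I" for t
    using time_deriv_eqI[OF I that q'[OF that]] .
  \<comment> \<open>The two functions agree on \<open>I\<close> only, which is enough for derivatives within \<open>I\<close>.\<close>
  have velocity': "(time_deriv I q has_vector_derivative
      - ((2 * d) *\<^sub>R p t) - (1 / L) *\<^sub>R gradient f (q t + \<beta> *\<^sub>R p t)) (at t within I)"
    if "t \<in> I" for t
    using that velocity p'[OF that] by (rule has_vector_derivative_transform)
  show ?rhs
    unfolding solves_second_order_def
    using q' velocity velocity' time_deriv_eqI[OF I _ velocity']
    by (auto intro: differentiableI_vector)
next
  assume rhs: ?rhs
  have "(q has_vector_derivative p t) (at t within I)" if "t \<in> I" for t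
    using rhs that has_time_deriv unfolding solves_second_order_def by metis
  moreover have "(p has_vector_derivative
      - ((2 * d) *\<^sub>R p t) - (1 / L) *\<^sub>R gradient f (q t + \<beta> *\<^sub>R p t)) (at t within I)"
    if t: "t \<in> I" for t
  proof -
    have "(p has_vector_derivative time_deriv I (time_deriv I q) t) (at t within I)"
      using rhs t has_time_deriv[of "time_deriv I q" t I]
      unfolding solves_second_order_def
      by (auto intro: has_vector_derivative_transform[OF t])
    moreover have "time_deriv I (time_deriv I q) t + (2 * d) *\<^sub>R p t
        + (1 / L) *\<^sub>R gradient f (q t + \<beta> *\<^sub>R p t) = 0"
      using rhs t unfolding solves_second_order_def by auto
    then have "time_deriv I (time_deriv I q) t
        = - ((2 * d) *\<^sub>R p t) - (1 / L) *\<^sub>R gradient f (q t + \<beta> *\<^sub>R p t)"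
      by (simp add: eq_neg_iff_add_eq_0 algebra_simps)
    ultimately show ?thesis
      by simp
  qed
  ultimately show ?lhs
    unfolding solves_first_order_def T F by auto
qed

lemma semi_implicit_euler_nesterov_step:
  fixes f :: "'a::real_inner \<Rightarrow> real"
  assumes T: "\<And>v. gradient T v = v"
    and F: "\<And>u v. - ((1 / L) *\<^sub>R gradient f u) + F u v
      = - ((2 * d) *\<^sub>R v) - (1 / L) *\<^sub>R gradient f (u + \<beta> *\<^sub>R v)"
    and \<beta>: "\<beta> = 1 - 2 * d"
    and euler: "semi_implicit_euler f L T F 1 q p"
  shows "q (Suc k) = (q k + \<beta> *\<^sub>R p k) - (1 / L) *\<^sub>R gradient f (q k + \<beta> *\<^sub>R p k)"
    and "p (Suc k) = q (Suc k) - q k"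
proof -
  have p: "p (Suc k) = p k + (- ((2 * d) *\<^sub>R p k) - (1 / L) *\<^sub>R gradient f (q k + \<beta> *\<^sub>R p k))"
    and q: "q (Suc k) = q k + p (Suc k)"
    using euler unfolding semi_implicit_euler_def T F by auto
  have "p k - (2 * d) *\<^sub>R p k = \<beta> *\<^sub>R p k"
    by (simp add: \<beta> scaleR_left_diff_distrib)
  then show "q (Suc k) = (q k + \<beta> *\<^sub>R p k) - (1 / L) *\<^sub>R gradient f (q k + \<beta> *\<^sub>R p k)"
    unfolding q p by (simp add: algebra_simps)
  show "p (Suc k) = q (Suc k) - q k"
    using q by simp
qed

theorem mainTheorem1:
  fixes f :: "real ^ 'n \<Rightarrow> real"
    and L \<kappa> d \<beta> :: real
    and T :: "real ^ 'n \<Rightarrow> real"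
    and f_NP :: "real ^ 'n \<Rightarrow> real ^ 'n \<Rightarrow> real ^ 'n"
  assumes L: "L > 0" and \<kappa>: "\<kappa> \<ge> 1"
    and diff: "\<forall>x. f differentiable (at x)"
    and lipschitz: "L-lipschitz_on UNIV (gradient f)"
    and strongly_convex: "\<forall>x y. f x \<ge> f y + gradient f y \<bullet> (x - y) + L / (2 * \<kappa>) * (norm (x - y))\<^sup>2"
    and minimum: "\<forall>x. f 0 \<le> f x" and f0: "f 0 = 0"
    and d: "d = 1 / (sqrt \<kappa> + 1)"
    and \<beta>: "\<beta> = (sqrt \<kappa> - 1) / (sqrt \<kappa> + 1)"
    and T: "T = (\<lambda>p. 1 / 2 * (norm p)\<^sup>2)"
    and f_NP: "f_NP = (\<lambda>q p. - ((2 * d) *\<^sub>R p) - (1 / L) *\<^sub>R (gradient f (q + \<beta> *\<^sub>R p) - gradient f q))"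
  shows
    "(\<forall>I q p. is_interval I \<and> interior I \<noteq> {} \<longrightarrow>
        (solves_first_order f L T f_NP I q p \<longleftrightarrow>
         solves_second_order f L d \<beta> I q \<and> (\<forall>t\<in>I. p t = time_deriv I q t))) \<and>
     (\<forall>q p x y. semi_implicit_euler f L T f_NP 1 q p \<and>
        (\<forall>k. x k = q k) \<and> (\<forall>k. y k = q k + \<beta> *\<^sub>R p k) \<longrightarrow>
        (\<forall>k. x (Suc k) = y k - (1 / L) *\<^sub>R gradient f (y k) \<and>
             y (Suc k) = x (Suc k) + \<beta> *\<^sub>R (x (Suc k) - x k)))"
proof -
  have "sqrt \<kappa> + 1 > 0"
    using \<kappa> by (simp add: add_nonneg_pos)
  then have \<beta>_d: "\<beta> = 1 - 2 * d"
    unfolding \<beta> d by (simp add: field_simps)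
  have grad_T: "gradient T v = v" for v
    unfolding T by (rule gradient_kinetic_energy)
  have force: "- ((1 / L) *\<^sub>R gradient f u) + f_NP u v
      = - ((2 * d) *\<^sub>R v) - (1 / L) *\<^sub>R gradient f (u + \<beta> *\<^sub>R v)" for u v
    unfolding f_NP by (simp add: scaleR_right_diff_distrib)
  show ?thesis
  proof (intro conjI allI impI; (elim conjE)?)
    fix I :: "real set" and q p :: "real \<Rightarrow> real ^ 'n"
    assume "is_interval I" "interior I \<noteq> {}"
    then show "solves_first_order f L T f_NP I q p \<longleftrightarrow>
        solves_second_order f L d \<beta> I q \<and> (\<forall>t\<in>I. p t = time_deriv I q t)"
      by (rule first_order_iff_second_order[OF _ _ grad_T force])
  next
    fix q p x y :: "nat \<Rightarrow> real ^ 'n" and k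
    assume euler: "semi_implicit_euler f L T f_NP 1 q p"
      and xy: "\<forall>k. x k = q k" "\<forall>k. y k = q k + \<beta> *\<^sub>R p k"
    note step = semi_implicit_euler_nesterov_step[OF grad_T force \<beta>_d euler]
    show "x (Suc k) = y k - (1 / L) *\<^sub>R gradient f (y k)"
      using step(1) by (simp only: xy)
    show "y (Suc k) = x (Suc k) + \<beta> *\<^sub>R (x (Suc k) - x k)"
      using step(2) by (simp only: xy)
  qed
qed

end
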